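(* Let $(H,\rho)$ be a complete CAT(0) space with the geodesic extension property and let $A:H\rightrightarrows TH$ be a monotone vector field with the surjectivity condition, with resolvents $J_\lambda$ ($\lambda>0$). Suppose $A^{-1}(\mathbf 0)\neq\emptyset$. Then for every $x\in H$, $$\lim_{\lambda\to\infty}J_\lambda x=P_{A^{-1}(\mathbf 0)}\,x .$$
   Context: Geodesics. In a complete CAT(0) space $(H,\rho)$, $\gamma_{x,y}:[0,1]\to H$ denotes the unique geodesic from $x$ to $y$ parametrized with constant speed $\rho(x,y)$; it is called a zero geodesic if $x=y$. For a normalized geodesic $\gamma$ (i.e. parametrized on $[0,1]$ with constant speed), $\zeta(\gamma)=0$ if $\gamma$ is a zero geodesic and $\zeta(\gamma)=1$ otherwise. $H$ has the geodesic extension property if for all $p,q\in H$ there is $\eta:\mathbb{R}\to H$ with $\eta(0)=p$, $\eta(1)=q$ and $\rho(\eta(s),\eta(t))=\rho(p,q)|s-t|$ for all $s,t\in\mathbb{R}$. For $C\subset H$ nonempty, closed and convex, $P_Cx$ is the unique point of $C$ nearest to $x$; under the hypotheses here $A^{-1}(\mathbf 0)$ (defined below) is nonempty, closed and convex. Tangent spaces. For $q,r\ne p$, the comparison angle $\overline\angle_p(q,r)$ is the angle at $\bar p$ in a Euclidean triangle $\bar p\bar q\bar r$ with the same side lengths as $p,q,r$; set $\overline\angle_p(p,p)=0$ and $\overline\angle_p(p,r)=\overline\angle_p(r,p)=\pi/2$ for $r\neq p$. The Alexandrov angle of geodesics $\gamma_1,\gamma_2$ issuing from $p$ is $\alpha_p(\gamma_1,\gamma_2)=\lim_{s,t\to0^+}\overline\angle_p(\gamma_1(s),\gamma_2(t))$.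 $S_p$ is the set of normalized geodesics issuing from $p$, modulo the relation $\alpha_p=0$, with induced metric $\angle_p$. $T_pH=([0,\infty)\times S_p)/\!\sim$, where $(t_1,\gamma_1)\sim(t_2,\gamma_2)$ iff either $t_1\zeta(\gamma_1)=t_2\zeta(\gamma_2)=0$, or $t_1\zeta(\gamma_1)=t_2\zeta(\gamma_2)>0$ and $\gamma_1=\gamma_2$ in $S_p$. The class of $(t,\gamma)$ is written $t\gamma$, and $\gamma$ stands for $1\gamma$. Put $0_p=0\gamma$ (also equal to $t\gamma_{p,p}$) and $g_p(t_1\gamma_1,t_2\gamma_2)=t_1t_2\zeta(\gamma_1)\zeta(\gamma_2)\cos\angle_p(\gamma_1,\gamma_2)$. $TH=\bigcup_{p\in H}T_pH$. Vector fields. A vector field is a set-valued map $A:H\rightrightarrows TH$ with $Ap\subset T_pH$ for all $p$ (possibly empty); $A^{-1}(\mathbf 0)=\{p\in H: 0_p\in Ap\}$. $A$ is monotone if $g_p(\eta,\gamma_{p,q})\le -g_q(\nu,\gamma_{q,p})$ whenever $\eta\in Ap$, $\nu\in Aq$. $A$ satisfies the surjectivity condition if for all $t>0$ and $x\in H$ there is $p\in H$ with $t\rho(p,x)\gamma_{p,x}\in Ap$. For $\lambda>0$, the resolvent is $J_\lambda x=\{z\in H:\lambda^{-1}\rho(z,x)\gamma_{z,x}\in Az\}$, which is a singleton for every $x\in H$ when $A$ is monotone with the surjectivity condition, and is then regarded as a map $J_\lambda:H\to H$. *)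

theory Defs
  imports "HOL-Analysis.Analysis"
begin

section \<open>Geodesics and CAT(0) spaces\<close>

text \<open>Normalized geodesics are functions on \<open>[0,1]\<close>; extensionality fixes their value
  outside \<open>[0,1]\<close>, so that equality of HOL functions is equality of geodesics.\<close>

definition geodesic :: "(real \<Rightarrow> 'a::metric_space) \<Rightarrow> bool" where
  "geodesic \<gamma> \<longleftrightarrow> \<gamma> \<in> extensional {0..1} \<and>
     (\<forall>s\<in>{0..1}. \<forall>t\<in>{0..1}. dist (\<gamma> s) (\<gamma> t) = dist (\<gamma> 0) (\<gamma> 1) * \<bar>s - t\<bar>)"

definition geodesic_between :: "'a::metric_space \<Rightarrow> 'a \<Rightarrow> (real \<Rightarrow> 'a) \<Rightarrow> bool" where
  "geodesic_between x y \<gamma> \<longleftrightarrow> geodesic \<gamma> \<and> \<gamma> 0 = x \<and> \<gamma> 1 = y"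

definition geod :: "'a::metric_space \<Rightarrow> 'a \<Rightarrow> real \<Rightarrow> 'a" where
  "geod x y = (THE \<gamma>. geodesic_between x y \<gamma>)"

definition zero_geodesic :: "(real \<Rightarrow> 'a::metric_space) \<Rightarrow> bool" where
  "zero_geodesic \<gamma> \<longleftrightarrow> geodesic \<gamma> \<and> \<gamma> 0 = \<gamma> 1"

definition comparison_triangle ::
    "'a::metric_space \<Rightarrow> 'a \<Rightarrow> 'a \<Rightarrow> real^2 \<Rightarrow> real^2 \<Rightarrow> real^2 \<Rightarrow> bool" where
  "comparison_triangle p q r p' q' r' \<longleftrightarrow>
     dist p' q' = dist p q \<and> dist q' r' = dist q r \<and> dist r' p' = dist r p"

text \<open>The CAT(0) inequality is stated for points on two sides issuing from a common vertex
  \<open>p\<close>. As \<open>p\<close>, \<open>q\<close>, \<open>r\<close> and the sides are arbitrary, this covers all pairs of points on a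
  geodesic triangle (for points on the same side the inequality is an equality).\<close>

definition CAT0 :: "'a::metric_space itself \<Rightarrow> bool" where
  "CAT0 (_ :: 'a itself) \<longleftrightarrow>
     (\<forall>x y :: 'a. \<exists>\<gamma>. geodesic_between x y \<gamma>) \<and>
     (\<forall>(p::'a) q r \<gamma> \<delta> p' q' r'.
        geodesic_between p q \<gamma> \<longrightarrow> geodesic_between p r \<delta> \<longrightarrow>
        comparison_triangle p q r p' q' r' \<longrightarrow>
        (\<forall>s\<in>{0..1}. \<forall>t\<in>{0..1}.
           dist (\<gamma> s) (\<delta> t)
             \<le> dist ((1 - s) *\<^sub>R p' + s *\<^sub>R q') ((1 - t) *\<^sub>R p' + t *\<^sub>R r')))"

definition geodesic_extension_property :: "'a::metric_space itself \<Rightarrow> bool" where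
  "geodesic_extension_property (_ :: 'a itself) \<longleftrightarrow>
     (\<forall>p q :: 'a. \<exists>\<eta> :: real \<Rightarrow> 'a. \<eta> 0 = p \<and> \<eta> 1 = q \<and>
        (\<forall>s t. dist (\<eta> s) (\<eta> t) = dist p q * \<bar>s - t\<bar>))"

definition nearest_point :: "'a::metric_space set \<Rightarrow> 'a \<Rightarrow> 'a" where
  "nearest_point C x = (THE p. p \<in> C \<and> (\<forall>q\<in>C. dist x p \<le> dist x q))"


section \<open>Angles\<close>

definition vec_angle :: "'v::real_inner \<Rightarrow> 'v \<Rightarrow> real" where
  "vec_angle u v = arccos (inner u v / (norm u * norm v))"

definition comparison_angle :: "'a::metric_space \<Rightarrow> 'a \<Rightarrow> 'a \<Rightarrow> real" where
  "comparison_angle p q r =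
     (if q = p \<and> r = p then 0
      else if q = p \<or> r = p then pi / 2
      else (THE \<theta>. \<exists>p' q' r'. comparison_triangle p q r p' q' r' \<and>
                              \<theta> = vec_angle (q' - p') (r' - p')))"

definition alexandrov_angle ::
    "'a::metric_space \<Rightarrow> (real \<Rightarrow> 'a) \<Rightarrow> (real \<Rightarrow> 'a) \<Rightarrow> real" where
  "alexandrov_angle p \<gamma>1 \<gamma>2 =
     Lim (at_right 0 \<times>\<^sub>F at_right 0) (\<lambda>(s, t). comparison_angle p (\<gamma>1 s) (\<gamma>2 t))"


section \<open>Tangent spaces\<close>

text \<open>A direction is a class of normalized geodesics; a tangent vector is a class of pairs of
  a nonnegative number and a direction. Classes at distinct base points are distinct, so the
  tangent bundle is the plain union of the tangent spaces.\<close>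

type_synonym 'a direction = "(real \<Rightarrow> 'a) set"
type_synonym 'a tangent = "(real \<times> 'a direction) set"

definition geodesics_from :: "'a::metric_space \<Rightarrow> (real \<Rightarrow> 'a) set" where
  "geodesics_from p = {\<gamma>. geodesic \<gamma> \<and> \<gamma> 0 = p}"

definition direction_rel :: "'a::metric_space \<Rightarrow> ((real \<Rightarrow> 'a) \<times> (real \<Rightarrow> 'a)) set" where
  "direction_rel p =
     {(\<gamma>1, \<gamma>2). \<gamma>1 \<in> geodesics_from p \<and> \<gamma>2 \<in> geodesics_from p \<and> alexandrov_angle p \<gamma>1 \<gamma>2 = 0}"

definition directions :: "'a::metric_space \<Rightarrow> 'a direction set" where
  "directions p = geodesics_from p // direction_rel p"

text \<open>For functions on quotients, \<^const>\<open>the_elem\<close> of the image over all representatives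
  is the common value.\<close>

definition direction_angle :: "'a::metric_space \<Rightarrow> 'a direction \<Rightarrow> 'a direction \<Rightarrow> real" where
  "direction_angle p c1 c2 = the_elem ((\<lambda>(\<gamma>1, \<gamma>2). alexandrov_angle p \<gamma>1 \<gamma>2) ` (c1 \<times> c2))"

definition zeta :: "'a::metric_space direction \<Rightarrow> real" where
  "zeta c = the_elem ((\<lambda>\<gamma>. if zero_geodesic \<gamma> then 0 else 1) ` c)"

definition tangent_rel ::
    "'a::metric_space \<Rightarrow> ((real \<times> 'a direction) \<times> (real \<times> 'a direction)) set" where
  "tangent_rel p =
     {((t1, c1), (t2, c2)).
        (t1, c1) \<in> {0..} \<times> directions p \<and> (t2, c2) \<in> {0..} \<times> directions p \<and>
        ((t1 * zeta c1 = 0 \<and> t2 * zeta c2 = 0) \<or>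
         (t1 * zeta c1 = t2 * zeta c2 \<and> t2 * zeta c2 > 0 \<and> c1 = c2))}"

definition tangent_space :: "'a::metric_space \<Rightarrow> 'a tangent set" where
  "tangent_space p = ({0..} \<times> directions p) // tangent_rel p"

text \<open>The class of \<open>(t, \<gamma>)\<close>, written \<open>t\<gamma>\<close> on paper.\<close>

definition tangent_vec :: "'a::metric_space \<Rightarrow> real \<Rightarrow> (real \<Rightarrow> 'a) \<Rightarrow> 'a tangent" where
  "tangent_vec p t \<gamma> = tangent_rel p `` {(t, direction_rel p `` {\<gamma>})}"

definition zero_vec :: "'a::metric_space \<Rightarrow> 'a tangent" where
  "zero_vec p = tangent_vec p 0 (geod p p)"

definition tangent_g :: "'a::metric_space \<Rightarrow> 'a tangent \<Rightarrow> 'a tangent \<Rightarrow> real" where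
  "tangent_g p v w =
     the_elem ((\<lambda>((t1, c1), (t2, c2)). t1 * t2 * zeta c1 * zeta c2 * cos (direction_angle p c1 c2))
                 ` (v \<times> w))"


section \<open>Vector fields\<close>

definition vector_field :: "('a::metric_space \<Rightarrow> 'a tangent set) \<Rightarrow> bool" where
  "vector_field A \<longleftrightarrow> (\<forall>p. A p \<subseteq> tangent_space p)"

definition zeros :: "('a::metric_space \<Rightarrow> 'a tangent set) \<Rightarrow> 'a set" where
  "zeros A = {p. zero_vec p \<in> A p}"

definition monotone_field :: "('a::metric_space \<Rightarrow> 'a tangent set) \<Rightarrow> bool" where
  "monotone_field A \<longleftrightarrow>
     (\<forall>p q. \<forall>\<eta>\<in>A p. \<forall>\<nu>\<in>A q.
        tangent_g p \<eta> (tangent_vec p 1 (geod p q)) \<le> - tangent_g q \<nu> (tangent_vec q 1 (geod q p)))"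

definition surjectivity_condition :: "('a::metric_space \<Rightarrow> 'a tangent set) \<Rightarrow> bool" where
  "surjectivity_condition A \<longleftrightarrow>
     (\<forall>t>0. \<forall>x. \<exists>p. tangent_vec p (t * dist p x) (geod p x) \<in> A p)"

definition resolvent_set :: "('a::metric_space \<Rightarrow> 'a tangent set) \<Rightarrow> real \<Rightarrow> 'a \<Rightarrow> 'a set" where
  "resolvent_set A l x = {z. tangent_vec z (inverse l * dist z x) (geod z x) \<in> A z}"

definition resolvent :: "('a::metric_space \<Rightarrow> 'a tangent set) \<Rightarrow> real \<Rightarrow> 'a \<Rightarrow> 'a" where
  "resolvent A l x = the_elem (resolvent_set A l x)"

end

theory Submission imports Defs begin

text \<open>In a CAT(0) space the comparison angle dominates the Alexandrov angle, so monotonicity of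
  \<open>A\<close> together with the law of cosines turns into inequalities between squared distances.
  For \<open>l \<le> m\<close> they give \<open>d(J_l x, J_m x)^2 \<le> d(x, J_m x)^2 - d(x, J_l x)^2\<close>, and for a zero
  \<open>p\<close> they give \<open>d(J_l x, p)^2 + d(x, J_l x)^2 \<le> d(x, p)^2\<close>. Hence \<open>d(x, J_l x)\<close> is monotone
  and bounded and \<open>J_l x\<close> is Cauchy. The limit \<open>q\<close> is fixed by \<open>J_1\<close>, hence a zero, and the
  second inequality passes to the limit and makes \<open>q\<close> the nearest zero.\<close>

section \<open>Euclidean comparison triangles and the law of cosines\<close>

text \<open>The law-of-cosines value of the cosine of the comparison angle at \<open>p\<close>. When
  \<open>q = p\<close> or \<open>r = p\<close>, division by zero gives 0, so the bounds below hold
  without side conditions.\<close>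

definition comparison_cos :: "'a::metric_space \<Rightarrow> 'a \<Rightarrow> 'a \<Rightarrow> real" where
  "comparison_cos p q r =
     ((dist p q)\<^sup>2 + (dist p r)\<^sup>2 - (dist q r)\<^sup>2) / (2 * dist p q * dist p r)"

text \<open>Square both halves of the triangle inequality
  \<open>\<bar>a - b\<bar> \<le> c \<le> a + b\<close>.\<close>

lemma comparison_cos_numerator_bounds:
  fixes p q r :: "'a::metric_space"
  shows "\<bar>(dist p q)\<^sup>2 + (dist p r)\<^sup>2 - (dist q r)\<^sup>2\<bar> \<le> 2 * dist p q * dist p r"
proof -
  have 1: "\<bar>dist p q - dist p r\<bar> \<le> dist q r"
    using dist_triangle[of p q r] dist_triangle[of p r q] by (simp add: dist_commute)
  have 2: "dist q r \<le> dist p q + dist p r"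
    using dist_triangle[of q r p] by (simp add: dist_commute)
  have "(dist p q - dist p r)\<^sup>2 \<le> (dist q r)\<^sup>2"
    using power_mono[OF 1, of 2] by simp
  moreover have "(dist q r)\<^sup>2 \<le> (dist p q + dist p r)\<^sup>2"
    using power_mono[OF 2, of 2] by simp
  ultimately show ?thesis by (simp add: power2_eq_square algebra_simps abs_le_iff)
qed

lemma comparison_cos_bounds: "-1 \<le> comparison_cos p q r" "comparison_cos p q r \<le> 1"
proof -
  have "\<bar>comparison_cos p q r\<bar> \<le> 1"
    unfolding comparison_cos_def abs_divide
    using comparison_cos_numerator_bounds[of p q r] by (intro divide_le_eq_1[THEN iffD2]) (auto simp: abs_mult)
  then show "-1 \<le> comparison_cos p q r" "comparison_cos p q r \<le> 1" by auto
qed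

text \<open>Put \<open>p'\<close> at the origin and \<open>q'\<close> on the first axis. The law of
  cosines dictates the first coordinate \<open>u\<close> of \<open>r'\<close>, and the numerator
  bound gives \<open>\<bar>u\<bar> \<le> b\<close>, so the height is a real square root. Since
  \<open>u\<close> divides by \<open>a\<close>, the case \<open>p = q\<close> is separate.\<close>

lemma comparison_triangle_exists:
  fixes p q r :: "'a::metric_space"
  shows "\<exists>p' q' r'. comparison_triangle p q r p' q' r'"
proof (cases "p = q")
  case True
  then have "comparison_triangle p q r 0 0 (vector [dist p r, 0])"
    by (simp add: comparison_triangle_def dist_vec_def L2_set_def UNIV_2 dist_commute)
  then show ?thesis by blast
next
  case False
  define a b c where "a = dist p q" and "b = dist p r" and "c = dist q r"
  define u where "u = (a\<^sup>2 + b\<^sup>2 - c\<^sup>2) / (2 * a)"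
  have a: "a > 0" using False by (simp add: a_def)
  have b: "b \<ge> 0" and c: "c \<ge> 0" by (simp_all add: b_def c_def)
  have "\<bar>u\<bar> \<le> b"
    using comparison_cos_numerator_bounds[of p q r] a
    by (simp add: u_def a_def b_def c_def abs_divide divide_simps abs_mult mult_ac)
  then have u2: "u\<^sup>2 \<le> b\<^sup>2" using b by (metis abs_of_nonneg abs_le_square_iff)
  have au: "2 * a * u = a\<^sup>2 + b\<^sup>2 - c\<^sup>2" using a by (simp add: u_def)
  have "(u - a)\<^sup>2 + (b\<^sup>2 - u\<^sup>2) = c\<^sup>2"
    using au by (simp add: power2_eq_square algebra_simps)
  then have "(a - u)\<^sup>2 + (b\<^sup>2 - u\<^sup>2) = c\<^sup>2" by (simp add: power2_commute)
  then have "comparison_triangle p q r 0 (vector [a, 0]) (vector [u, sqrt (b\<^sup>2 - u\<^sup>2)])"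
    using u2 a b c
    by (simp add: comparison_triangle_def dist_vec_def L2_set_def UNIV_2 dist_commute dist_real_def
        flip: a_def b_def c_def)
  then show ?thesis by blast
qed

lemma comparison_triangle_inner:
  assumes "comparison_triangle p q r p' q' r'"
  shows "inner (q' - p') (r' - p') = ((dist p q)\<^sup>2 + (dist p r)\<^sup>2 - (dist q r)\<^sup>2) / 2"
proof -
  have "norm (q' - p') = dist p q" "norm (r' - p') = dist p r"
    "norm ((q' - p') - (r' - p')) = dist q r"
    using assms by (simp_all add: comparison_triangle_def dist_norm norm_minus_commute dist_commute)
  then show ?thesis
    using dot_norm_neg[of "q' - p'" "r' - p'"] by simp
qed

text \<open>All comparison triangles share the same norms and inner product, so the
  \<open>THE\<close> in the definition denotes a unique value.\<close>

lemma comparison_angle_eq_arccos: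
  assumes "q \<noteq> p" "r \<noteq> p"
  shows "comparison_angle p q r = arccos (comparison_cos p q r)"
proof -
  have ang: "vec_angle (q' - p') (r' - p') = arccos (comparison_cos p q r)"
    if t: "comparison_triangle p q r p' q' r'" for p' q' r'
  proof -
    have "norm (q' - p') = dist p q" "norm (r' - p') = dist p r"
      using t by (simp_all add: comparison_triangle_def dist_norm norm_minus_commute dist_commute)
    then show ?thesis
      by (simp add: vec_angle_def comparison_triangle_inner[OF t] comparison_cos_def mult_ac)
  qed
  have not_both: "\<not> (q = p \<and> r = p)" and not_either: "\<not> (q = p \<or> r = p)"
    using assms by auto
  show ?thesis
    unfolding comparison_angle_def if_not_P[OF not_both] if_not_P[OF not_either]
    using comparison_triangle_exists[of p q r] ang by (intro the_equality) (metis, metis)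
qed

section \<open>The CAT(0) inequality in terms of distances, and geodesics from a point\<close>

text \<open>Expand the squared Euclidean distance and replace the inner product by the law of
  cosines. This removes the comparison triangle; later arguments use the inequality only in this
  form.\<close>

lemma CAT0_dist_power2_le:
  fixes p :: "'a::metric_space"
  assumes "CAT0 TYPE('a)" "geodesic_between p q \<gamma>" "geodesic_between p r \<delta>"
    and "s \<in> {0..1}" "t \<in> {0..1}"
  shows "(dist (\<gamma> s) (\<delta> t))\<^sup>2 \<le> s\<^sup>2 * (dist p q)\<^sup>2 + t\<^sup>2 * (dist p r)\<^sup>2
           - s * t * ((dist p q)\<^sup>2 + (dist p r)\<^sup>2 - (dist q r)\<^sup>2)"
proof -
  obtain p' q' r' where tri: "comparison_triangle p q r p' q' r'"
    using comparison_triangle_exists by blast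
  define u v where "u = q' - p'" and "v = r' - p'"
  have uv: "norm u = dist p q" "norm v = dist p r"
    using tri by (simp_all add: u_def v_def comparison_triangle_def dist_norm norm_minus_commute dist_commute)
  have inn: "2 * inner u v = (dist p q)\<^sup>2 + (dist p r)\<^sup>2 - (dist q r)\<^sup>2"
    using comparison_triangle_inner[OF tri] by (simp add: u_def v_def)
  have "dist (\<gamma> s) (\<delta> t) \<le> dist ((1 - s) *\<^sub>R p' + s *\<^sub>R q') ((1 - t) *\<^sub>R p' + t *\<^sub>R r')"
    using assms tri unfolding CAT0_def by blast
  also have "\<dots> = norm (s *\<^sub>R u - t *\<^sub>R v)"
    by (simp add: dist_norm u_def v_def algebra_simps)
  finally have "(dist (\<gamma> s) (\<delta> t))\<^sup>2 \<le> (norm (s *\<^sub>R u - t *\<^sub>R v))\<^sup>2"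
    by (intro power_mono) auto
  also have "\<dots> = s\<^sup>2 * (norm u)\<^sup>2 + t\<^sup>2 * (norm v)\<^sup>2 - s * t * (2 * inner u v)"
    unfolding power2_norm_eq_inner
    by (simp add: inner_diff_left inner_diff_right power2_eq_square algebra_simps inner_commute)
  finally show ?thesis unfolding uv inn .
qed

lemma CAT0_ex1_geodesic:
  fixes x y :: "'a::metric_space"
  assumes "CAT0 TYPE('a)"
  shows "\<exists>!\<gamma>. geodesic_between x y \<gamma>"
proof -
  have "\<gamma> = \<delta>" if g: "geodesic_between x y \<gamma>" "geodesic_between x y \<delta>" for \<gamma> \<delta>
  proof (rule extensionalityI)
    show "\<gamma> \<in> extensional {0..1}" "\<delta> \<in> extensional {0..1}"
      using g by (auto simp: geodesic_between_def geodesic_def)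
    fix s :: real assume s: "s \<in> {0..1}"
    \<comment> \<open>With \<open>q = r\<close> and \<open>s = t\<close> the right side of the
      inequality cancels to 0.\<close>
    have "(dist (\<gamma> s) (\<delta> s))\<^sup>2 \<le> 0"
      using CAT0_dist_power2_le[OF assms g s s] by (simp add: power2_eq_square)
    then show "\<gamma> s = \<delta> s" by simp
  qed
  then show ?thesis using assms unfolding CAT0_def by blast
qed

lemma CAT0_geod_between:
  fixes x y :: "'a::metric_space"
  assumes "CAT0 TYPE('a)"
  shows "geodesic_between x y (geod x y)"
  unfolding geod_def by (rule theI'[OF CAT0_ex1_geodesic[OF assms]])

lemma geodesics_from_iff:
  "\<gamma> \<in> geodesics_from p \<longleftrightarrow> \<gamma> \<in> extensional {0..1} \<and> \<gamma> 0 = p \<and>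
     (\<forall>s\<in>{0..1}. \<forall>t\<in>{0..1}. dist (\<gamma> s) (\<gamma> t) = dist p (\<gamma> 1) * \<bar>s - t\<bar>)"
  unfolding geodesics_from_def geodesic_def by blast

lemma geodesics_from_dist:
  assumes "\<gamma> \<in> geodesics_from p" "s \<in> {0..1}"
  shows "dist p (\<gamma> s) = dist p (\<gamma> 1) * s"
proof -
  have "\<gamma> 0 = p" using assms(1) unfolding geodesics_from_iff by blast
  moreover have "dist (\<gamma> 0) (\<gamma> s) = dist p (\<gamma> 1) * \<bar>0 - s\<bar>"
    using assms unfolding geodesics_from_iff by (meson atLeastAtMost_iff order_refl zero_le_one)
  ultimately show ?thesis using assms(2) by simp
qed

lemma geodesics_from_eq_base_iff:
  assumes "\<gamma> \<in> geodesics_from p" "0 < s" "s \<le> 1"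
  shows "\<gamma> s = p \<longleftrightarrow> \<gamma> 1 = p"
proof -
  have "dist p (\<gamma> s) = 0 \<longleftrightarrow> dist p (\<gamma> 1) = 0"
    using geodesics_from_dist[OF assms(1), of s] assms(2,3) by simp
  then show ?thesis by auto
qed

text \<open>Lets the CAT(0) inequality be applied to smaller triangles at \<open>p\<close>. The
  \<open>restrict\<close> supplies the extensionality that \<open>geodesic\<close> demands.\<close>

lemma geodesics_from_initial_segment:
  assumes "\<gamma> \<in> geodesics_from p" "s \<in> {0..1}"
  shows "geodesic_between p (\<gamma> s) (restrict (\<lambda>u. \<gamma> (s * u)) {0..1})"
proof -
  have g0: "\<gamma> 0 = p" using assms(1) unfolding geodesics_from_iff by blast
  have "dist (\<gamma> (s * u)) (\<gamma> (s * v)) = dist p (\<gamma> s) * \<bar>u - v\<bar>"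
    if "u \<in> {0..1}" "v \<in> {0..1}" for u v
  proof -
    have "s * u \<in> {0..1}" "s * v \<in> {0..1}"
      using assms(2) that by (auto intro: mult_le_one)
    then have "dist (\<gamma> (s * u)) (\<gamma> (s * v)) = dist p (\<gamma> 1) * \<bar>s * u - s * v\<bar>"
      using assms(1) unfolding geodesics_from_iff by blast
    also have "\<dots> = dist p (\<gamma> 1) * s * \<bar>u - v\<bar>"
      using assms(2) by (simp add: abs_mult flip: right_diff_distrib)
    finally show ?thesis by (simp add: geodesics_from_dist[OF assms])
  qed
  then show ?thesis by (simp add: geodesic_between_def geodesic_def g0)
qed

section \<open>Existence of Alexandrov angles\<close>

text \<open>Apply the CAT(0) inequality to the triangle \<open>p\<close>, \<open>\<gamma> s\<close>,
  \<open>\<delta> t\<close> at the fractions \<open>\<sigma>\<close> and \<open>\<tau>\<close> of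
  its sides, then divide by \<open>\<sigma> * \<tau> * (2 * a * b)\<close>: both sides become
  comparison cosines.\<close>

lemma comparison_cos_antimono:
  fixes p :: "'a::metric_space"
  assumes cat: "CAT0 TYPE('a)"
    and g: "\<gamma> \<in> geodesics_from p" "\<delta> \<in> geodesics_from p" "\<gamma> 1 \<noteq> p" "\<delta> 1 \<noteq> p"
    and s: "0 < s'" "s' \<le> s" "s \<le> 1" and t: "0 < t'" "t' \<le> t" "t \<le> 1"
  shows "comparison_cos p (\<gamma> s) (\<delta> t) \<le> comparison_cos p (\<gamma> s') (\<delta> t')"
proof -
  define a b where "a = dist p (\<gamma> s)" and "b = dist p (\<delta> t)"
  define \<sigma> \<tau> where "\<sigma> = s' / s" and "\<tau> = t' / t"
  have st: "0 < \<sigma>" "\<sigma> \<le> 1" "0 < \<tau>" "\<tau> \<le> 1" using s t by (auto simp: \<sigma>_def \<tau>_def)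
  have ab: "a > 0" "b > 0"
    using geodesics_from_dist[OF g(1), of s] geodesics_from_dist[OF g(2), of t] s t g(3,4)
    by (simp_all add: a_def b_def)
  have a': "dist p (\<gamma> s') = \<sigma> * a" "dist p (\<delta> t') = \<tau> * b"
    using geodesics_from_dist[OF g(1), of s] geodesics_from_dist[OF g(2), of t]
      geodesics_from_dist[OF g(1), of s'] geodesics_from_dist[OF g(2), of t'] s t
    by (simp_all add: a_def b_def \<sigma>_def \<tau>_def)
  have "(dist (\<gamma> s') (\<delta> t'))\<^sup>2 \<le> \<sigma>\<^sup>2 * a\<^sup>2 + \<tau>\<^sup>2 * b\<^sup>2 - \<sigma> * \<tau> * (a\<^sup>2 + b\<^sup>2 - (dist (\<gamma> s) (\<delta> t))\<^sup>2)"
    using CAT0_dist_power2_le[OF cat geodesics_from_initial_segment[OF g(1), of s]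
        geodesics_from_initial_segment[OF g(2), of t], of \<sigma> \<tau>] s t st
    by (simp add: a_def b_def \<sigma>_def \<tau>_def)
  then have "\<sigma> * \<tau> * (a\<^sup>2 + b\<^sup>2 - (dist (\<gamma> s) (\<delta> t))\<^sup>2) / (\<sigma> * \<tau> * (2 * a * b))
      \<le> ((\<sigma> * a)\<^sup>2 + (\<tau> * b)\<^sup>2 - (dist (\<gamma> s') (\<delta> t'))\<^sup>2) / (\<sigma> * \<tau> * (2 * a * b))"
    using st ab by (intro divide_right_mono) (auto simp: power_mult_distrib)
  then show ?thesis
    using st ab by (simp add: comparison_cos_def a' mult_ac flip: a_def b_def)
qed

lemma eventually_at_right_0_prod:
  assumes "(0::real) < s0" "(0::real) < t0"
    and "\<And>s t. 0 < s \<Longrightarrow> s \<le> s0 \<Longrightarrow> 0 < t \<Longrightarrow> t \<le> t0 \<Longrightarrow> P (s, t)"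
  shows "eventually P (at_right 0 \<times>\<^sub>F at_right 0)"
proof -
  have ev: "eventually (\<lambda>s. 0 < s \<and> s \<le> c) (at_right 0)" if "0 < c" for c :: real
    unfolding eventually_at_right_field using that by (intro exI[of _ c]) auto
  show ?thesis
    unfolding eventually_prod_filter using ev[OF assms(1)] ev[OF assms(2)] assms(3) by blast
qed

lemma alexandrov_angle_unique:
  assumes "((\<lambda>(s, t). comparison_angle p (\<gamma> s) (\<delta> t)) \<longlongrightarrow> \<alpha>) (at_right 0 \<times>\<^sub>F at_right 0)"
  shows "alexandrov_angle p \<gamma> \<delta> = \<alpha>"
  unfolding alexandrov_angle_def
  by (rule tendsto_Lim[OF _ assms]) (simp add: prod_filter_eq_bot)

text \<open>The comparison cosine grows as the points approach \<open>p\<close> and is bounded by 1,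
  so it converges to its supremum \<open>L\<close>, which dominates the value at
  \<open>(1, 1)\<close>. Continuity of \<open>arccos\<close> transfers the limit to the
  angles.\<close>

lemma CAT0_alexandrov_angle:
  fixes p :: "'a::metric_space"
  assumes cat: "CAT0 TYPE('a)"
    and g: "\<gamma> \<in> geodesics_from p" "\<delta> \<in> geodesics_from p" "\<gamma> 1 \<noteq> p" "\<delta> 1 \<noteq> p"
  shows "((\<lambda>(s, t). comparison_cos p (\<gamma> s) (\<delta> t)) \<longlongrightarrow> cos (alexandrov_angle p \<gamma> \<delta>))
           (at_right 0 \<times>\<^sub>F at_right 0)"
    and "comparison_cos p (\<gamma> 1) (\<delta> 1) \<le> cos (alexandrov_angle p \<gamma> \<delta>)"
    and "alexandrov_angle p \<gamma> \<delta> \<in> {0..pi}"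
proof -
  let ?F = "at_right (0::real) \<times>\<^sub>F at_right (0::real)"
  let ?f = "\<lambda>(s, t). comparison_cos p (\<gamma> s) (\<delta> t)"
  let ?D = "{0<..1} \<times> {0<..1} :: (real \<times> real) set"
  define L where "L = Sup (?f ` ?D)"
  have bdd: "bdd_above (?f ` ?D)"
    by (intro bdd_aboveI[of _ 1]) (auto simp: comparison_cos_bounds)
  have ub: "comparison_cos p (\<gamma> s) (\<delta> t) \<le> L" if "0 < s" "s \<le> 1" "0 < t" "t \<le> 1" for s t
    unfolding L_def using that by (intro cSup_upper bdd) (auto intro: image_eqI[of _ _ "(s, t)"])
  have L1: "L \<le> 1"
    unfolding L_def by (rule cSup_least) (auto simp: comparison_cos_bounds)
  have Lm1: "-1 \<le> L"
    using ub[of 1 1] comparison_cos_bounds(1)[of p "\<gamma> 1" "\<delta> 1"] by simp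
  have lim: "(?f \<longlongrightarrow> L) ?F"
  proof (rule order_tendstoI)
    fix a assume "a < L"
    then obtain s0 t0 where st: "0 < s0" "s0 \<le> 1" "0 < t0" "t0 \<le> 1"
      and a: "a < comparison_cos p (\<gamma> s0) (\<delta> t0)"
      unfolding L_def using less_cSup_iff[OF _ bdd, of a] by auto
    \<comment> \<open>By monotonicity the bound at \<open>(s0, t0)\<close> persists for all smaller
      parameters.\<close>
    show "eventually (\<lambda>z. a < ?f z) ?F"
      by (rule eventually_at_right_0_prod[OF st(1,3)])
        (use a comparison_cos_antimono[OF cat g] st in \<open>force intro: less_le_trans\<close>)
  next
    fix a assume "L < a"
    show "eventually (\<lambda>z. ?f z < a) ?F"
      by (rule eventually_at_right_0_prod[of 1 1]) (use ub \<open>L < a\<close> in \<open>auto intro: le_less_trans\<close>)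
  qed
  have "((\<lambda>z. arccos (?f z)) \<longlongrightarrow> arccos L) ?F"
    using continuous_on_arccos' lim
    by (rule continuous_on_tendsto_compose)
      (use L1 Lm1 in \<open>auto simp: comparison_cos_bounds split: prod.splits intro!: always_eventually\<close>)
  moreover have "eventually (\<lambda>z. arccos (?f z) = (\<lambda>(s, t). comparison_angle p (\<gamma> s) (\<delta> t)) z) ?F"
  proof (rule eventually_at_right_0_prod[of 1 1])
    fix s t :: real assume st: "0 < s" "s \<le> 1" "0 < t" "t \<le> 1"
    have "\<gamma> s \<noteq> p" "\<delta> t \<noteq> p"
      using geodesics_from_eq_base_iff[OF g(1), of s] geodesics_from_eq_base_iff[OF g(2), of t] st g(3,4)
      by auto
    then show "arccos (?f (s, t)) = (\<lambda>(s, t). comparison_angle p (\<gamma> s) (\<delta> t)) (s, t)"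
      by (simp add: comparison_angle_eq_arccos)
  qed auto
  ultimately have "((\<lambda>(s, t). comparison_angle p (\<gamma> s) (\<delta> t)) \<longlongrightarrow> arccos L) ?F"
    by (rule Lim_transform_eventually)
  then have \<alpha>: "alexandrov_angle p \<gamma> \<delta> = arccos L" by (rule alexandrov_angle_unique)
  then have cos: "cos (alexandrov_angle p \<gamma> \<delta>) = L" using L1 Lm1 by simp
  show "(?f \<longlongrightarrow> cos (alexandrov_angle p \<gamma> \<delta>)) ?F" using lim cos by simp
  show "comparison_cos p (\<gamma> 1) (\<delta> 1) \<le> cos (alexandrov_angle p \<gamma> \<delta>)" using ub[of 1 1] cos by simp
  show "alexandrov_angle p \<gamma> \<delta> \<in> {0..pi}" using \<alpha> L1 Lm1 by (simp add: arccos_lbound arccos_ubound)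
qed

text \<open>The comparison angles are constant for parameters in \<open>(0,1]\<close>, so the
  conventions for degenerate triangles pass directly to the limit.\<close>

lemma alexandrov_angle_zero_geodesic:
  assumes g: "\<gamma> \<in> geodesics_from p" "\<delta> \<in> geodesics_from p" and "\<gamma> 1 = p \<or> \<delta> 1 = p"
  shows "alexandrov_angle p \<gamma> \<delta> = (if \<gamma> 1 = p \<and> \<delta> 1 = p then 0 else pi / 2)"
proof (rule alexandrov_angle_unique, rule tendsto_eventually,
    rule eventually_at_right_0_prod[of 1 1])
  fix s t :: real assume st: "0 < s" "s \<le> 1" "0 < t" "t \<le> 1"
  have "\<gamma> s = p \<longleftrightarrow> \<gamma> 1 = p" "\<delta> t = p \<longleftrightarrow> \<delta> 1 = p"
    using geodesics_from_eq_base_iff[OF g(1), of s] geodesics_from_eq_base_iff[OF g(2), of t] st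
    by auto
  then show "(\<lambda>(s, t). comparison_angle p (\<gamma> s) (\<delta> t)) (s, t)
      = (if \<gamma> 1 = p \<and> \<delta> 1 = p then 0 else pi / 2)"
    using assms(3) by (auto simp: comparison_angle_def)
qed auto

section \<open>Angles depend only on directions\<close>

text \<open>At time \<open>e / dist p (\<gamma> 1)\<close> the geodesic is at distance
  \<open>e\<close> from \<open>p\<close>. The two points thus span an isosceles triangle with legs
  \<open>e\<close>, whose chord divided by \<open>e\<close> is \<open>sqrt (2 - 2 * cos)\<close> of
  the comparison angle.\<close>

lemma CAT0_chord_limit:
  fixes p :: "'a::metric_space"
  assumes cat: "CAT0 TYPE('a)"
    and g: "\<gamma> \<in> geodesics_from p" "\<delta> \<in> geodesics_from p" "\<gamma> 1 \<noteq> p" "\<delta> 1 \<noteq> p"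
  shows "((\<lambda>e. dist (\<gamma> (e / dist p (\<gamma> 1))) (\<delta> (e / dist p (\<delta> 1))) / e)
           \<longlongrightarrow> sqrt (2 - 2 * cos (alexandrov_angle p \<gamma> \<delta>))) (at_right 0)"
proof -
  define a b where "a = dist p (\<gamma> 1)" and "b = dist p (\<delta> 1)"
  have ab: "a > 0" "b > 0" using g(3,4) by (simp_all add: a_def b_def)
  \<comment> \<open>Specializes the two-variable limit to a curve on which both points stay at equal
    distance from \<open>p\<close>.\<close>
  have "filterlim (\<lambda>e. (e / a, e / b)) (at_right 0 \<times>\<^sub>F at_right 0) (at_right 0)"
    using ab by (intro filterlim_Pair)
      (auto simp: filterlim_at eventually_at_filter intro!: tendsto_eq_intros always_eventually)
  from filterlim_compose[OF CAT0_alexandrov_angle(1)[OF assms] this]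
  have "((\<lambda>e. comparison_cos p (\<gamma> (e / a)) (\<delta> (e / b))) \<longlongrightarrow> cos (alexandrov_angle p \<gamma> \<delta>)) (at_right 0)"
    by simp
  then have "((\<lambda>e. sqrt (2 - 2 * comparison_cos p (\<gamma> (e / a)) (\<delta> (e / b))))
      \<longlongrightarrow> sqrt (2 - 2 * cos (alexandrov_angle p \<gamma> \<delta>))) (at_right 0)"
    by (intro tendsto_intros)
  moreover have "eventually (\<lambda>e. sqrt (2 - 2 * comparison_cos p (\<gamma> (e / a)) (\<delta> (e / b)))
      = dist (\<gamma> (e / a)) (\<delta> (e / b)) / e) (at_right 0)"
    unfolding eventually_at_right_field
  proof (intro exI[of _ "min a b"] conjI allI impI)
    \<comment> \<open>The bound by \<open>min a b\<close> keeps both times in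
      \<open>[0,1]\<close>.\<close>
    fix e assume e: "0 < e" "e < min a b"
    have d: "dist p (\<gamma> (e / a)) = e" "dist p (\<delta> (e / b)) = e"
      using geodesics_from_dist[OF g(1), of "e / a"] geodesics_from_dist[OF g(2), of "e / b"] e ab
      by (simp_all add: a_def b_def)
    have "2 - 2 * comparison_cos p (\<gamma> (e / a)) (\<delta> (e / b)) = (dist (\<gamma> (e / a)) (\<delta> (e / b)) / e)\<^sup>2"
      using e by (simp add: comparison_cos_def d power2_eq_square field_simps)
    then show "sqrt (2 - 2 * comparison_cos p (\<gamma> (e / a)) (\<delta> (e / b))) = dist (\<gamma> (e / a)) (\<delta> (e / b)) / e"
      using e by simp
  qed (use ab in auto)
  ultimately show ?thesis unfolding a_def b_def by (rule Lim_transform_eventually)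
qed

text \<open>All chords at equal distance from \<open>p\<close> vanish, so the cosine is 1.\<close>

lemma CAT0_alexandrov_angle_refl:
  fixes p :: "'a::metric_space"
  assumes cat: "CAT0 TYPE('a)" and g: "\<gamma> \<in> geodesics_from p"
  shows "alexandrov_angle p \<gamma> \<gamma> = 0"
proof (cases "\<gamma> 1 = p")
  case True
  then show ?thesis using alexandrov_angle_zero_geodesic[OF g g] by simp
next
  case False
  let ?\<alpha> = "alexandrov_angle p \<gamma> \<gamma>"
  have "((\<lambda>e::real. 0) \<longlongrightarrow> sqrt (2 - 2 * cos ?\<alpha>)) (at_right 0)"
    using CAT0_chord_limit[OF cat g g False False] by simp
  then have "sqrt (2 - 2 * cos ?\<alpha>) = 0"
    by (simp add: tendsto_const_iff)
  then have "cos ?\<alpha> = cos 0" by simp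
  moreover have "?\<alpha> \<in> {0..pi}" by (rule CAT0_alexandrov_angle(3)[OF cat g g False False])
  ultimately show ?thesis using cos_inj_pi[of ?\<alpha> 0] by auto
qed

text \<open>A zero and a nonzero geodesic meet at angle \<open>pi / 2\<close>, so no direction class
  mixes the two kinds; this makes \<open>zeta\<close> well defined.\<close>

lemma alexandrov_angle_0_endpoint:
  assumes "\<gamma> \<in> geodesics_from p" "\<delta> \<in> geodesics_from p" "alexandrov_angle p \<gamma> \<delta> = 0"
  shows "\<gamma> 1 = p \<longleftrightarrow> \<delta> 1 = p"
  using alexandrov_angle_zero_geodesic[OF assms(1,2)] assms(3) pi_gt_zero
  by (cases "\<gamma> 1 = p"; cases "\<delta> 1 = p") auto

text \<open>Both angles are read off from chords at scale \<open>e\<close>, and geodesics at angle \<open>0\<close> are only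
  \<open>o(e)\<close> apart there, so the triangle inequality of the metric suffices; the triangle
  inequality for angles is not needed.\<close>

lemma CAT0_alexandrov_angle_cong:
  fixes p :: "'a::metric_space"
  assumes cat: "CAT0 TYPE('a)"
    and g: "\<gamma> \<in> geodesics_from p" "\<gamma>' \<in> geodesics_from p"
    and d: "\<delta> \<in> geodesics_from p" "\<delta>' \<in> geodesics_from p"
    and \<gamma>0: "alexandrov_angle p \<gamma> \<gamma>' = 0" and \<delta>0: "alexandrov_angle p \<delta> \<delta>' = 0"
  shows "alexandrov_angle p \<gamma> \<delta> = alexandrov_angle p \<gamma>' \<delta>'"
proof (cases "\<gamma> 1 = p \<or> \<delta> 1 = p")
  case True
  then show ?thesis
    using alexandrov_angle_0_endpoint[OF g \<gamma>0] alexandrov_angle_0_endpoint[OF d \<delta>0]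
      alexandrov_angle_zero_geodesic[OF g(1) d(1)] alexandrov_angle_zero_geodesic[OF g(2) d(2)]
    by simp
next
  case False
  then have ne: "\<gamma> 1 \<noteq> p" "\<delta> 1 \<noteq> p" "\<gamma>' 1 \<noteq> p" "\<delta>' 1 \<noteq> p"
    using alexandrov_angle_0_endpoint[OF g \<gamma>0] alexandrov_angle_0_endpoint[OF d \<delta>0] by auto
  let ?pt = "\<lambda>\<gamma> e. \<gamma> (e / dist p (\<gamma> 1))"
  let ?\<alpha> = "alexandrov_angle p \<gamma> \<delta>" and ?\<alpha>' = "alexandrov_angle p \<gamma>' \<delta>'"
  have lim: "((\<lambda>e. dist (?pt \<gamma> e) (?pt \<delta> e) / e - dist (?pt \<gamma>' e) (?pt \<delta>' e) / e)
      \<longlongrightarrow> sqrt (2 - 2 * cos ?\<alpha>) - sqrt (2 - 2 * cos ?\<alpha>')) (at_right 0)"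
    by (intro tendsto_diff CAT0_chord_limit cat g d ne)
  have "((\<lambda>e. dist (?pt \<gamma> e) (?pt \<gamma>' e) / e + dist (?pt \<delta> e) (?pt \<delta>' e) / e) \<longlongrightarrow>
      sqrt (2 - 2 * cos (alexandrov_angle p \<gamma> \<gamma>')) + sqrt (2 - 2 * cos (alexandrov_angle p \<delta> \<delta>')))
      (at_right 0)"
    by (intro tendsto_add CAT0_chord_limit cat g d ne)
  then have "((\<lambda>e. dist (?pt \<gamma> e) (?pt \<gamma>' e) / e + dist (?pt \<delta> e) (?pt \<delta>' e) / e) \<longlongrightarrow> 0) (at_right 0)"
    by (simp add: \<gamma>0 \<delta>0)
  moreover have "eventually (\<lambda>e. norm (dist (?pt \<gamma> e) (?pt \<delta> e) / e - dist (?pt \<gamma>' e) (?pt \<delta>' e) / e)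
      \<le> dist (?pt \<gamma> e) (?pt \<gamma>' e) / e + dist (?pt \<delta> e) (?pt \<delta>' e) / e) (at_right 0)"
    using eventually_at_right_less[of 0]
  proof eventually_elim
    case (elim e)
    have "dist (?pt \<gamma> e) (?pt \<delta> e) \<le> dist (?pt \<gamma> e) (?pt \<gamma>' e) + dist (?pt \<gamma>' e) (?pt \<delta>' e) + dist (?pt \<delta> e) (?pt \<delta>' e)"
      using dist_triangle[of "?pt \<gamma> e" "?pt \<delta> e" "?pt \<gamma>' e"]
        dist_triangle2[of "?pt \<gamma>' e" "?pt \<delta> e" "?pt \<delta>' e"] by linarith
    moreover have "dist (?pt \<gamma>' e) (?pt \<delta>' e) \<le> dist (?pt \<gamma> e) (?pt \<gamma>' e) + dist (?pt \<gamma> e) (?pt \<delta> e) + dist (?pt \<delta> e) (?pt \<delta>' e)"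
      using dist_triangle3[of "?pt \<gamma>' e" "?pt \<delta>' e" "?pt \<gamma> e"]
        dist_triangle[of "?pt \<gamma> e" "?pt \<delta>' e" "?pt \<delta> e"] by linarith
    ultimately show ?case
      using elim by (simp add: divide_right_mono abs_le_iff flip: diff_divide_distrib add_divide_distrib)
  qed
  ultimately have "((\<lambda>e. dist (?pt \<gamma> e) (?pt \<delta> e) / e - dist (?pt \<gamma>' e) (?pt \<delta>' e) / e) \<longlongrightarrow> 0) (at_right 0)"
    by (rule Lim_null_comparison[rotated])
  then have "sqrt (2 - 2 * cos ?\<alpha>) - sqrt (2 - 2 * cos ?\<alpha>') = 0"
    using lim by (intro tendsto_unique[of "at_right 0"]) auto
  then have "cos ?\<alpha> = cos ?\<alpha>'" by simp
  moreover have "?\<alpha> \<in> {0..pi}" "?\<alpha>' \<in> {0..pi}"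
    using CAT0_alexandrov_angle(3) cat g d ne by blast+
  ultimately show ?thesis using cos_inj_pi[of ?\<alpha> ?\<alpha>'] by auto
qed

section \<open>Evaluating the functions on the quotients\<close>

lemma direction_rel_iff:
  assumes "\<gamma> \<in> geodesics_from p"
  shows "\<gamma>' \<in> direction_rel p `` {\<gamma>} \<longleftrightarrow> \<gamma>' \<in> geodesics_from p \<and> alexandrov_angle p \<gamma> \<gamma>' = 0"
  using assms by (auto simp: direction_rel_def)

text \<open>Reflexivity makes the image nonempty and congruence makes it a singleton, so
  \<open>the_elem\<close> returns the common value.\<close>

lemma CAT0_direction_angle:
  fixes p :: "'a::metric_space"
  assumes cat: "CAT0 TYPE('a)" and g: "\<gamma> \<in> geodesics_from p" "\<delta> \<in> geodesics_from p"
  shows "direction_angle p (direction_rel p `` {\<gamma>}) (direction_rel p `` {\<delta>}) = alexandrov_angle p \<gamma> \<delta>"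
proof -
  have "(\<gamma>, \<delta>) \<in> (direction_rel p `` {\<gamma>}) \<times> (direction_rel p `` {\<delta>})"
    unfolding mem_Times_iff fst_conv snd_conv direction_rel_iff[OF g(1)] direction_rel_iff[OF g(2)]
    using g CAT0_alexandrov_angle_refl[OF cat] by simp
  moreover have "(case z of (\<gamma>', \<delta>') \<Rightarrow> alexandrov_angle p \<gamma>' \<delta>') = alexandrov_angle p \<gamma> \<delta>"
    if "z \<in> (direction_rel p `` {\<gamma>}) \<times> (direction_rel p `` {\<delta>})" for z
    using that CAT0_alexandrov_angle_cong[OF cat g(1) _ g(2)]
    unfolding mem_Times_iff direction_rel_iff[OF g(1)] direction_rel_iff[OF g(2)]
    by (auto simp: split_beta)
  ultimately have "(\<lambda>(\<gamma>', \<delta>'). alexandrov_angle p \<gamma>' \<delta>') ` ((direction_rel p `` {\<gamma>}) \<times> (direction_rel p `` {\<delta>}))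
      = {alexandrov_angle p \<gamma> \<delta>}"
    by (intro equalityI subsetI) (blast, metis (no_types, lifting) case_prod_conv image_eqI singletonD)
  then show ?thesis by (simp add: direction_angle_def)
qed

lemma CAT0_zeta:
  fixes p :: "'a::metric_space"
  assumes cat: "CAT0 TYPE('a)" and g: "\<gamma> \<in> geodesics_from p"
  shows "zeta (direction_rel p `` {\<gamma>}) = (if \<gamma> 1 = p then 0 else 1)"
proof -
  have "\<gamma> \<in> direction_rel p `` {\<gamma>}"
    unfolding direction_rel_iff[OF g] using g CAT0_alexandrov_angle_refl[OF cat g] by simp
  moreover have "zero_geodesic \<gamma>' \<longleftrightarrow> \<gamma> 1 = p" if "\<gamma>' \<in> direction_rel p `` {\<gamma>}" for \<gamma>'
    using that alexandrov_angle_0_endpoint[OF g]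
    unfolding direction_rel_iff[OF g] zero_geodesic_def geodesics_from_def mem_Collect_eq by metis
  ultimately have "(\<lambda>\<gamma>. if zero_geodesic \<gamma> then 0 else 1) ` (direction_rel p `` {\<gamma>})
      = {if \<gamma> 1 = p then 0 else 1 :: real}"
    by (auto intro!: image_eqI[of _ _ \<gamma>])
  then show ?thesis by (simp add: zeta_def)
qed

text \<open>A tangent vector determines the product \<open>t * zeta c\<close>, and also
  \<open>c\<close> unless that product is 0. Hence the value is the same for all
  representatives.\<close>

lemma CAT0_tangent_g:
  fixes p :: "'a::metric_space"
  assumes cat: "CAT0 TYPE('a)" and g: "\<gamma> \<in> geodesics_from p" "\<delta> \<in> geodesics_from p"
    and "t \<ge> 0" "u \<ge> 0"
  shows "tangent_g p (tangent_vec p t \<gamma>) (tangent_vec p u \<delta>) =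
     (if \<gamma> 1 = p \<or> \<delta> 1 = p then 0 else t * u * cos (alexandrov_angle p \<gamma> \<delta>))"
proof -
  let ?c = "direction_rel p `` {\<gamma>}" and ?d = "direction_rel p `` {\<delta>}"
  let ?f = "\<lambda>((t1, c1), (t2, c2)). t1 * t2 * zeta c1 * zeta c2 * cos (direction_angle p c1 c2)"
  have mem: "(t, direction_rel p `` {\<gamma>}) \<in> tangent_vec p t \<gamma>" if "\<gamma> \<in> geodesics_from p" "t \<ge> 0" for t \<gamma>
  proof -
    have "direction_rel p `` {\<gamma>} \<in> directions p"
      unfolding directions_def using that(1) by (rule quotientI)
    moreover have "t * zeta (direction_rel p `` {\<gamma>}) = 0 \<or> t * zeta (direction_rel p `` {\<gamma>}) > 0"
      using that(2) by (auto simp: CAT0_zeta[OF cat that(1)])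
    ultimately show ?thesis
      using that(2) unfolding tangent_vec_def tangent_rel_def Image_singleton_iff by simp
  qed
  have rep: "t1 * zeta c1 = t * zeta (direction_rel p `` {\<gamma>}) \<and>
      (t * zeta (direction_rel p `` {\<gamma>}) = 0 \<or> c1 = direction_rel p `` {\<gamma>})"
    if "(t1, c1) \<in> tangent_vec p t \<gamma>" for t1 c1 t \<gamma>
    using that by (auto simp: tangent_vec_def tangent_rel_def)
  have "?f z = ?f ((t, ?c), (u, ?d))" if "z \<in> tangent_vec p t \<gamma> \<times> tangent_vec p u \<delta>" for z
  proof -
    obtain t1 c1 t2 c2 where z: "z = ((t1, c1), (t2, c2))" by (metis surj_pair)
    have 1: "t1 * zeta c1 = t * zeta ?c" "t * zeta ?c = 0 \<or> c1 = ?c"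
      and 2: "t2 * zeta c2 = u * zeta ?d" "u * zeta ?d = 0 \<or> c2 = ?d"
      using rep[of t1 c1 t \<gamma>] rep[of t2 c2 u \<delta>] that by (auto simp: z)
    have "?f z = (t1 * zeta c1) * (t2 * zeta c2) * cos (direction_angle p c1 c2)"
      by (simp add: z mult_ac)
    \<comment> \<open>Where the directions may differ, one of the factors is 0 and the cosine does
      not matter.\<close>
    also have "\<dots> = (t * zeta ?c) * (u * zeta ?d) * cos (direction_angle p ?c ?d)"
      using 1 2 by (metis mult_zero_left mult_zero_right)
    finally show ?thesis by (simp add: mult_ac)
  qed
  then have "tangent_g p (tangent_vec p t \<gamma>) (tangent_vec p u \<delta>) = ?f ((t, ?c), (u, ?d))"
    unfolding tangent_g_def using mem[OF g(1) assms(4)] mem[OF g(2) assms(5)]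
    by (intro the_elem_image_unique) auto
  then show ?thesis
    using CAT0_zeta[OF cat] CAT0_direction_angle[OF cat] g by simp
qed

section \<open>From monotonicity to inequalities between squared distances\<close>

text \<open>Here \<open>c\<close> is the cosine of the Alexandrov angle, which is at least the
  comparison cosine. If \<open>x = p\<close> or \<open>q = p\<close>, take \<open>c = 0\<close>: the
  left side of the inequality is then 0 as well.\<close>

lemma CAT0_tangent_g_law_of_cosines:
  fixes p x q :: "'a::metric_space"
  assumes cat: "CAT0 TYPE('a)"
  obtains c where "\<And>t. t \<ge> 0 \<Longrightarrow> tangent_g p (tangent_vec p t (geod p x)) (tangent_vec p 1 (geod p q)) = t * c"
    and "(dist p x)\<^sup>2 + (dist p q)\<^sup>2 - (dist x q)\<^sup>2 \<le> 2 * dist p x * dist p q * c"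
proof -
  have g: "geod p x \<in> geodesics_from p" "geod p q \<in> geodesics_from p"
    and e: "geod p x 1 = x" "geod p q 1 = q"
    using CAT0_geod_between[OF cat, of p x] CAT0_geod_between[OF cat, of p q]
    by (auto simp: geodesic_between_def geodesics_from_def)
  show ?thesis
  proof (cases "x = p \<or> q = p")
    case True
    show ?thesis
      by (rule that[of 0]) (use True CAT0_tangent_g[OF cat g] e in \<open>auto simp: dist_commute\<close>)
  next
    case False
    let ?c = "cos (alexandrov_angle p (geod p x) (geod p q))"
    have "comparison_cos p x q \<le> ?c"
      using CAT0_alexandrov_angle(2)[OF cat g] e False by simp
    then have "(dist p x)\<^sup>2 + (dist p q)\<^sup>2 - (dist x q)\<^sup>2 \<le> 2 * dist p x * dist p q * ?c"
      using False by (subst (asm) comparison_cos_def, subst (asm) pos_divide_le_eq)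
        (auto simp: mult_ac)
    then show ?thesis
      by (intro that[of ?c]) (use False CAT0_tangent_g[OF cat g] e in auto)
  qed
qed

text \<open>Each bracket is at most \<open>2 * dist z w\<close> times a pairing of a field vector
  with the direction to the other point, scaled accordingly, and monotonicity makes the sum of the
  two pairings nonpositive. A factor \<open>inverse l\<close> describes resolvent points; a factor 0
  describes zeros of \<open>A\<close>.\<close>

lemma monotone_field_radial:
  fixes A :: "'a::metric_space \<Rightarrow> 'a tangent set"
  assumes cat: "CAT0 TYPE('a)" and mono: "monotone_field A" and a: "a \<ge> 0" and b: "b \<ge> 0"
    and z: "tangent_vec z (a * dist z x) (geod z x) \<in> A z"
    and w: "tangent_vec w (b * dist w y) (geod w y) \<in> A w"
  shows "a * ((dist z x)\<^sup>2 + (dist z w)\<^sup>2 - (dist x w)\<^sup>2)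
         + b * ((dist w y)\<^sup>2 + (dist z w)\<^sup>2 - (dist y z)\<^sup>2) \<le> 0"
proof -
  obtain c where c: "\<And>t. t \<ge> 0 \<Longrightarrow> tangent_g z (tangent_vec z t (geod z x)) (tangent_vec z 1 (geod z w)) = t * c"
    "(dist z x)\<^sup>2 + (dist z w)\<^sup>2 - (dist x w)\<^sup>2 \<le> 2 * dist z x * dist z w * c"
    using CAT0_tangent_g_law_of_cosines[OF cat, of z x w] by blast
  obtain d where d: "\<And>t. t \<ge> 0 \<Longrightarrow> tangent_g w (tangent_vec w t (geod w y)) (tangent_vec w 1 (geod w z)) = t * d"
    "(dist w y)\<^sup>2 + (dist z w)\<^sup>2 - (dist y z)\<^sup>2 \<le> 2 * dist w y * dist z w * d"
    using CAT0_tangent_g_law_of_cosines[OF cat, of w y z] unfolding dist_commute[of w z] by blast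
  have m: "a * dist z x * c \<le> - (b * dist w y * d)"
    using mono z w c(1)[of "a * dist z x"] d(1)[of "b * dist w y"] a b
    unfolding monotone_field_def by (metis mult_nonneg_nonneg zero_le_dist)
  have "a * ((dist z x)\<^sup>2 + (dist z w)\<^sup>2 - (dist x w)\<^sup>2)
      + b * ((dist w y)\<^sup>2 + (dist z w)\<^sup>2 - (dist y z)\<^sup>2)
      \<le> a * (2 * dist z x * dist z w * c) + b * (2 * dist w y * dist z w * d)"
    using a b c(2) d(2) by (intro add_mono mult_left_mono)
  also have "\<dots> = 2 * dist z w * (a * dist z x * c + b * dist w y * d)"
    by (simp add: algebra_simps)
  also have "\<dots> \<le> 0"
    using m by (intro mult_nonneg_nonpos) auto
  finally show ?thesis .
qed

text \<open>Surjectivity with \<open>t = inverse l\<close> gives a resolvent point. For two of them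
  the radial inequality with equal factors collapses to
  \<open>2 * inverse l * (dist z w)\<^sup>2 \<le> 0\<close>, so \<open>the_elem\<close> is applied
  to a singleton.\<close>

lemma resolvent_in_field:
  fixes A :: "'a::metric_space \<Rightarrow> 'a tangent set"
  assumes cat: "CAT0 TYPE('a)" and mono: "monotone_field A" and surj: "surjectivity_condition A"
    and l: "l > 0"
  shows "tangent_vec (resolvent A l x) (inverse l * dist (resolvent A l x) x) (geod (resolvent A l x) x)
           \<in> A (resolvent A l x)"
proof -
  obtain z where z: "z \<in> resolvent_set A l x"
    using surj positive_imp_inverse_positive[OF l]
    unfolding surjectivity_condition_def resolvent_set_def by blast
  have "w = z" if w: "w \<in> resolvent_set A l x" for w
  proof -
    have "inverse l * ((dist z x)\<^sup>2 + (dist z w)\<^sup>2 - (dist x w)\<^sup>2)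
        + inverse l * ((dist w x)\<^sup>2 + (dist z w)\<^sup>2 - (dist x z)\<^sup>2) \<le> 0"
      using monotone_field_radial[OF cat mono, of "inverse l" "inverse l" z x w x] l z w
      by (simp add: resolvent_set_def)
    then have "inverse l * (dist z w)\<^sup>2 \<le> 0" by (simp add: algebra_simps dist_commute)
    then show ?thesis using l by (simp add: mult_le_0_iff)
  qed
  then have "resolvent_set A l x = {z}" using z by blast
  then have "resolvent A l x = z" by (simp add: resolvent_def)
  then show ?thesis using z by (simp add: resolvent_set_def)
qed

text \<open>A zero is a point of its own resolvent set for parameter 1; the factor
  \<open>1 *\<close> matches the shape of \<open>surjectivity_condition\<close>.\<close>

lemma zeros_iff_radial: "p \<in> zeros A \<longleftrightarrow> tangent_vec p (1 * dist p p) (geod p p) \<in> A p"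
  by (simp add: zeros_def zero_vec_def)

section \<open>Convergence of the resolvents\<close>

theorem theorem4p13:
  fixes A :: "'a::complete_space \<Rightarrow> 'a tangent set" and x :: 'a
  assumes "CAT0 TYPE('a)"
    and "geodesic_extension_property TYPE('a)"
    and "vector_field A"
    and "monotone_field A"
    and "surjectivity_condition A"
    and "zeros A \<noteq> {}"
  shows "((\<lambda>l. resolvent A l x) \<longlongrightarrow> nearest_point (zeros A) x) at_top"
proof -
  define J where "J l = resolvent A l x" for l
  define D where "D l = (dist x (J l))\<^sup>2" for l
  note radial = monotone_field_radial[OF assms(1,4)]
  have J: "tangent_vec (J l) (inverse l * dist (J l) x) (geod (J l) x) \<in> A (J l)" if "l > 0" for l
    unfolding J_def by (rule resolvent_in_field[OF assms(1,4,5) that])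

  have zero: "(dist (J l) p)\<^sup>2 + D l \<le> (dist x p)\<^sup>2" if "l > 0" "p \<in> zeros A" for l p
  proof -
    \<comment> \<open>The zero \<open>p\<close> enters with factor 0, which removes the second
      bracket.\<close>
    have "inverse l * ((dist (J l) x)\<^sup>2 + (dist (J l) p)\<^sup>2 - (dist x p)\<^sup>2) \<le> 0"
      using radial[OF _ _ J[OF that(1)], of 0 p p] that by (simp add: zeros_def zero_vec_def)
    then show ?thesis using that(1) by (simp add: D_def mult_le_0_iff dist_commute)
  qed

  have mono: "(dist (J l) (J m))\<^sup>2 \<le> D m - D l" if "0 < l" "l \<le> m" for l m
  proof (cases "l = m")
    case False
    define a b where "a = inverse l" and "b = inverse m"
    have ab: "0 < b" "b < a" using that False by (simp_all add: a_def b_def)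
    have "a * (D l + (dist (J l) (J m))\<^sup>2 - D m) + b * (D m + (dist (J l) (J m))\<^sup>2 - D l) \<le> 0"
      using radial[OF _ _ J[of l] J[of m]] that by (simp add: D_def a_def b_def dist_commute)
    then have "(a - b) * ((dist (J l) (J m))\<^sup>2 - (D m - D l)) + 2 * b * (dist (J l) (J m))\<^sup>2 \<le> 0"
      by (simp add: algebra_simps)
    moreover have "0 \<le> 2 * b * (dist (J l) (J m))\<^sup>2" using ab by simp
    ultimately have "(a - b) * ((dist (J l) (J m))\<^sup>2 - (D m - D l)) \<le> 0" by linarith
    then show ?thesis using ab by (simp add: mult_le_0_iff)
  qed simp

  obtain p0 where p0: "p0 \<in> zeros A" using assms(6) by blast
  define S where "S = Sup (D ` {0<..})"
  have bdd: "bdd_above (D ` {0<..})"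
  proof (rule bdd_aboveI2)
    show "D l \<le> (dist x p0)\<^sup>2" if "l \<in> {0<..}" for l
    proof -
      have "(dist (J l) p0)\<^sup>2 + D l \<le> (dist x p0)\<^sup>2" using that by (intro zero[OF _ p0]) simp
      then show ?thesis using zero_le_power2[of "dist (J l) p0"] by linarith
    qed
  qed
  have DS: "D l \<le> S" if "l > 0" for l
    unfolding S_def using that bdd by (intro cSup_upper) auto

  have "\<exists>q. (J \<longlongrightarrow> q) at_top"
  proof -
    \<comment> \<open>The parameter is real, so completeness is applied to the image filter instead
      of a sequence.\<close>
    have "cauchy_filter (filtermap J at_top)"
      unfolding cauchy_filter_metric
    proof (intro allI impI)
      fix e :: real assume e: "e > 0"
      \<comment> \<open>For \<open>l \<le> m \<le> n\<close> the squared distance is at most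
        \<open>D n - D m\<close>, hence at most \<open>S - D l\<close>, which is below
        \<open>e\<^sup>2\<close>.\<close>
      obtain l where l: "l > 0" "S - e\<^sup>2 < D l"
        using less_cSup_iff[OF _ bdd, of "S - e\<^sup>2"] e unfolding S_def[symmetric] by auto
      have "dist (J m) (J n) < e" if "l \<le> m" "m \<le> n" for m n
      proof -
        have "(dist (J m) (J n))\<^sup>2 < e\<^sup>2"
          using mono[of m n] mono[of l m] DS[of n] l that zero_le_power2[of "dist (J l) (J m)"]
          by linarith
        then show ?thesis using e by (simp add: power2_less_imp_less)
      qed
      then have "dist (J m) (J n) < e" if "l \<le> m" "l \<le> n" for m n
        using that by (metis dist_commute linear)
      then show "\<exists>P. eventually P (filtermap J at_top) \<and> (\<forall>y z. P y \<and> P z \<longrightarrow> dist y z < e)"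
        by (intro exI[of _ "\<lambda>y. y \<in> J ` {l..}"])
          (auto simp: eventually_filtermap eventually_at_top_linorder)
    qed
    then show ?thesis
      using cauchy_filter_complete_converges[of "filtermap J at_top" UNIV] complete_UNIV
      by (auto simp: filterlim_def filtermap_bot_iff)
  qed
  then obtain q where q: "(J \<longlongrightarrow> q) at_top" by blast

  have qz: "q \<in> zeros A"
  proof -
    \<comment> \<open>Surjectivity with \<open>t = 1\<close> provides a resolvent point
      \<open>y\<close> of \<open>q\<close>; it remains to show \<open>y = q\<close>.\<close>
    obtain y where y: "tangent_vec y (1 * dist y q) (geod y q) \<in> A y"
      using assms(5) unfolding surjectivity_condition_def by (metis zero_less_one)
    \<comment> \<open>The radial inequality for \<open>J l\<close> and \<open>y\<close>. As
      \<open>l\<close> grows, the \<open>inverse l\<close> term vanishes and the rest tends to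
      \<open>2 * (dist q y)\<^sup>2\<close>.\<close>
    let ?h = "\<lambda>l. inverse l * ((dist (J l) x)\<^sup>2 + (dist (J l) y)\<^sup>2 - (dist x y)\<^sup>2)
        + 1 * ((dist y q)\<^sup>2 + (dist (J l) y)\<^sup>2 - (dist q (J l))\<^sup>2)"
    have "?h l \<le> 0" if "l > 0" for l
      using that by (intro radial[OF _ _ J y]) auto
    then have "eventually (\<lambda>l. ?h l \<le> 0) at_top"
      using eventually_gt_at_top[of "0::real"] by (rule eventually_mono[rotated])
    moreover have "(?h \<longlongrightarrow> 0 * ((dist q x)\<^sup>2 + (dist q y)\<^sup>2 - (dist x y)\<^sup>2)
        + 1 * ((dist y q)\<^sup>2 + (dist q y)\<^sup>2 - (dist q q)\<^sup>2)) at_top"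
      by (intro tendsto_intros q tendsto_inverse_0_at_top filterlim_ident)
    ultimately have "0 * ((dist q x)\<^sup>2 + (dist q y)\<^sup>2 - (dist x y)\<^sup>2)
        + 1 * ((dist y q)\<^sup>2 + (dist q y)\<^sup>2 - (dist q q)\<^sup>2) \<le> 0"
      by (intro tendsto_upperbound[of ?h _ "at_top :: real filter"]) simp_all
    then have "y = q" by (simp add: dist_commute)
    then show ?thesis using y by (simp only: zeros_iff_radial)
  qed

  have proj: "(dist q p)\<^sup>2 + (dist x q)\<^sup>2 \<le> (dist x p)\<^sup>2" if "p \<in> zeros A" for p
  proof (rule tendsto_upperbound)
    show "((\<lambda>l. (dist (J l) p)\<^sup>2 + (dist x (J l))\<^sup>2) \<longlongrightarrow> (dist q p)\<^sup>2 + (dist x q)\<^sup>2) at_top"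
      by (intro tendsto_intros q)
    show "eventually (\<lambda>l. (dist (J l) p)\<^sup>2 + (dist x (J l))\<^sup>2 \<le> (dist x p)\<^sup>2) at_top"
      using eventually_gt_at_top[of 0] by eventually_elim (use zero[OF _ that] in \<open>simp add: D_def\<close>)
  qed simp
  have min: "dist x q \<le> dist x p" if "p \<in> zeros A" for p
  proof (rule power2_le_imp_le)
    show "(dist x q)\<^sup>2 \<le> (dist x p)\<^sup>2"
      using proj[OF that] zero_le_power2[of "dist q p"] by linarith
  qed simp
  \<comment> \<open>\<open>nearest_point\<close> is a \<open>THE\<close>, so uniqueness is required;
    it comes from the extra term \<open>(dist q p)\<^sup>2\<close> in \<open>proj\<close>.\<close>
  have uniq: "p = q" if p: "p \<in> zeros A" "\<forall>r\<in>zeros A. dist x p \<le> dist x r" for p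
  proof -
    have "(dist x p)\<^sup>2 \<le> (dist x q)\<^sup>2" using p(2) qz by (intro power_mono) auto
    then have "(dist q p)\<^sup>2 \<le> 0" using proj[OF p(1)] by linarith
    then show "p = q" by simp
  qed
  have "nearest_point (zeros A) x = q"
    unfolding nearest_point_def using qz min uniq by (intro the_equality) blast+
  then show ?thesis using q by (simp add: J_def[abs_def])
qed

end
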